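(* Let $K$ be a real quadratic number field with ring of integers $\mathcal O_K$. If there exists a $\mathbb Z$-form that is universal over $\mathcal O_K$, then $K=\mathbb Q(\sqrt 5)$.
   Context: A $\mathbb Z$-form is a positive definite quadratic form $Q(x_1,\dots,x_r)=\sum_{i\ge j}a_{ij}x_ix_j$ with all $a_{ij}\in\mathbb Z$. An element $\alpha\in K$ is totally positive if all its real embeddings are positive. A $\mathbb Z$-form $Q$ of rank $r$ is universal over $\mathcal O_K$ if for every totally positive $\alpha\in\mathcal O_K$ there is $v\in\mathcal O_K^r$ with $Q(v)=\alpha$. *)

theory Defs
  imports Complex_Main "HOL-Computational_Algebra.Polynomial"
begin

text \<open>
  A number field is represented as a subfield \<open>K\<close> of an arbitrary ambient field of
  characteristic 0.  This covers both subfields of the real or complex numbers and abstract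
  fields (take \<open>K = UNIV\<close>).
\<close>

definition is_subfield :: "'a::field set \<Rightarrow> bool" where
  "is_subfield K \<longleftrightarrow> 0 \<in> K \<and> 1 \<in> K \<and>
     (\<forall>x\<in>K. \<forall>y\<in>K. x + y \<in> K \<and> x * y \<in> K) \<and>
     (\<forall>x\<in>K. - x \<in> K \<and> inverse x \<in> K)"

lemma vector_space_rat: "vector_space (\<lambda>(q::rat) (x::'a::field_char_0). of_rat q * x)"
  by unfold_locales (simp_all add: algebra_simps of_rat_add of_rat_mult)

text \<open>
  The degree over the rationals.  Its value is 0 if \<open>K\<close> is infinite-dimensional, so
  \<open>rat_degree K = 2\<close> includes finite-dimensionality.
\<close>

definition rat_degree :: "'a::field_char_0 set \<Rightarrow> nat" where
  "rat_degree K = vector_space.dim (\<lambda>(q::rat) (x::'a). of_rat q * x) K"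

definition real_embedding :: "'a::field set \<Rightarrow> ('a \<Rightarrow> real) \<Rightarrow> bool" where
  "real_embedding K \<phi> \<longleftrightarrow> \<phi> 1 = 1 \<and>
     (\<forall>x\<in>K. \<forall>y\<in>K. \<phi> (x + y) = \<phi> x + \<phi> y \<and> \<phi> (x * y) = \<phi> x * \<phi> y)"

text \<open>
  A quadratic field is Galois over the rationals, so one real embedding is enough for all of its
  embeddings into the complex numbers to be real.
\<close>

definition real_quadratic_field :: "'a::field_char_0 set \<Rightarrow> bool" where
  "real_quadratic_field K \<longleftrightarrow>
     is_subfield K \<and> rat_degree K = 2 \<and> (\<exists>\<phi>. real_embedding K \<phi>)"

definition ring_of_integers :: "'a::field set \<Rightarrow> 'a set" where
  "ring_of_integers K = {x \<in> K. algebraic_int x}"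

definition totally_positive :: "'a::field set \<Rightarrow> 'a \<Rightarrow> bool" where
  "totally_positive K \<alpha> \<longleftrightarrow> (\<forall>\<phi>. real_embedding K \<phi> \<longrightarrow> \<phi> \<alpha> > 0)"

text \<open>
  An integral quadratic form of rank \<open>r\<close> is given by its coefficients \<open>a i j\<close>
  with \<open>j \<le> i < r\<close>; the other values of \<open>a\<close> are irrelevant.
\<close>

definition qf_eval :: "nat \<Rightarrow> (nat \<Rightarrow> nat \<Rightarrow> int) \<Rightarrow> (nat \<Rightarrow> 'a::comm_ring_1) \<Rightarrow> 'a" where
  "qf_eval r a x = (\<Sum>i<r. \<Sum>j\<le>i. of_int (a i j) * x i * x j)"

definition Z_form :: "nat \<Rightarrow> (nat \<Rightarrow> nat \<Rightarrow> int) \<Rightarrow> bool" where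
  "Z_form r a \<longleftrightarrow> (\<forall>x::nat \<Rightarrow> real. (\<exists>i<r. x i \<noteq> 0) \<longrightarrow> qf_eval r a x > 0)"

definition universal_over_integers ::
    "'a::field set \<Rightarrow> nat \<Rightarrow> (nat \<Rightarrow> nat \<Rightarrow> int) \<Rightarrow> bool" where
  "universal_over_integers K r a \<longleftrightarrow>
     (\<forall>\<alpha>\<in>ring_of_integers K. totally_positive K \<alpha> \<longrightarrow>
        (\<exists>v. (\<forall>i<r. v i \<in> ring_of_integers K) \<and> qf_eval r a v = \<alpha>))"

text \<open>
  In characteristic 0 the smallest subfield containing \<open>s\<close> is the rationals with \<open>s\<close> adjoined.
\<close>

definition rat_adjoin :: "'a::field_char_0 \<Rightarrow> 'a set" where
  "rat_adjoin s = is_subfield hull {s}"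

end

theory Submission
  imports Defs "HOL-Computational_Algebra.Squarefree"
begin

text \<open>
  Write the ring of integers of \<open>K\<close> as \<open>\<int> + \<int>w\<close> with \<open>w\<^sup>2 = t w + m\<close>, \<open>t \<in> {0, 1}\<close>, \<open>m > 0\<close>.  If \<open>B\<close> is
  the polar form of \<open>Q\<close>, then \<open>Q(x + y w) = (Q(x) + m Q(y)) + (B(x, y) + t Q(y)) w\<close> for integral
  vectors \<open>x\<close>, \<open>y\<close>.  Let \<open>n \<ge> 0\<close> be maximal with \<open>n\<^sup>2 + t n < m\<close>; then \<open>n + 1 + w\<close> is totally
  positive.  If \<open>Q\<close> represents it, the linear functional \<open>a + b w \<mapsto> a - n b\<close> (the trace against a totally
  positive element of the codifferent) gives \<open>Q(x - n y) + (m - t n - n\<^sup>2) Q(y) = 1\<close>.  Both summands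
  are nonnegative integers and \<open>y \<noteq> 0\<close>, so \<open>x = n y\<close> and \<open>Q(y) = 1\<close>.  The coefficient of \<open>w\<close> is then
  \<open>2 n + t = 1\<close>, whence \<open>t = 1\<close>, \<open>n = 0\<close>, \<open>m = 1\<close>, which is discriminant 5.
\<close>

section \<open>Integral forms evaluated at \<open>x + y w\<close>, and the choice of
  \<open>n\<close>\<close>

text \<open>The bilinear form Q(x + y) - Q(x) - Q(y) in coefficients. Without a factor 1/2 it stays
  integral on integral vectors.\<close>

definition polar_form :: "nat \<Rightarrow> (nat \<Rightarrow> nat \<Rightarrow> int) \<Rightarrow> (nat \<Rightarrow> 'a::comm_ring_1) \<Rightarrow> (nat \<Rightarrow> 'a) \<Rightarrow> 'a" where
  "polar_form r a x y = (\<Sum>i<r. \<Sum>j\<le>i. of_int (a i j) * (x i * y j + y i * x j))"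

lemma qf_eval_cong: "(\<And>i. i < r \<Longrightarrow> x i = y i) \<Longrightarrow> qf_eval r a x = qf_eval r a y"
  unfolding qf_eval_def by (intro sum.cong refl) auto

lemma polar_form_cong:
  "(\<And>i. i < r \<Longrightarrow> x i = x' i) \<Longrightarrow> (\<And>i. i < r \<Longrightarrow> y i = y' i) \<Longrightarrow>
    polar_form r a x y = polar_form r a x' y'"
  unfolding polar_form_def by (intro sum.cong refl) auto

lemma of_int_qf_eval: "of_int (qf_eval r a x) = qf_eval r a (\<lambda>i. of_int (x i))"
  by (simp add: qf_eval_def)

lemma of_int_polar_form:
  "of_int (polar_form r a x y) = polar_form r a (\<lambda>i. of_int (x i)) (\<lambda>i. of_int (y i))"
  by (simp add: polar_form_def)

lemma polar_form_scale_self: "polar_form r a (\<lambda>i. c * x i) x = 2 * c * qf_eval r a x"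
  unfolding polar_form_def qf_eval_def sum_distrib_left
  by (intro sum.cong refl) (simp add: algebra_simps)

text \<open>Expand each monomial and reduce by the equation of \<open>w\<close>. Any commutative
  ring is allowed, so \<open>w\<close> may be a generator of the ring of integers or just an
  integer.\<close>

lemma qf_eval_quadratic_extension:
  assumes "w\<^sup>2 = t * w + m"
  shows "qf_eval r a (\<lambda>i. x i + y i * w) =
    (qf_eval r a x + m * qf_eval r a y) + (polar_form r a x y + t * qf_eval r a y) * w"
proof -
  have "c * (x i + y i * w) * (x j + y j * w) =
      (c * x i * x j + m * (c * y i * y j)) +
      (c * (x i * y j + y i * x j) + t * (c * y i * y j)) * w" for c i j
  proof -
    have "c * (x i + y i * w) * (x j + y j * w) =
        c * x i * x j + c * (x i * y j + y i * x j) * w + c * y i * y j * w\<^sup>2"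
      by (simp add: algebra_simps power2_eq_square)
    then show ?thesis
      unfolding assms by (simp add: algebra_simps)
  qed
  then show ?thesis
    unfolding qf_eval_def polar_form_def
    by (simp add: sum.distrib sum_distrib_left sum_distrib_right distrib_right)
qed

lemma Z_form_pos_int:
  assumes "Z_form r a" "\<exists>i<r. x i \<noteq> (0::int)"
  shows "qf_eval r a x > 0"
proof -
  have "qf_eval r a (\<lambda>i. real_of_int (x i)) > 0"
    using assms by (auto simp: Z_form_def)
  then show ?thesis
    by (simp flip: of_int_qf_eval)
qed

lemma Z_form_nonneg_int: "Z_form r a \<Longrightarrow> qf_eval r a (x :: nat \<Rightarrow> int) \<ge> 0"
  by (cases "\<exists>i<r. x i \<noteq> 0") (force dest: Z_form_pos_int simp: qf_eval_def)+

text \<open>\<open>c0\<close> and \<open>c1\<close> are the two coordinates of the equation Q(x + y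
  w) = n + 1 + w.\<close>

lemma represented_imp_golden:
  fixes x y :: "nat \<Rightarrow> int" and n t m :: int
  assumes Z: "Z_form r a" and "n \<ge> 0" "t \<ge> 0" and n: "n\<^sup>2 + t * n < m"
    and c0: "qf_eval r a x + m * qf_eval r a y = n + 1"
    and c1: "polar_form r a x y + t * qf_eval r a y = 1"
  shows "t = 1 \<and> n = 0 \<and> m = 1"
proof -
  define z where "z i = x i - n * y i" for i
  \<comment> \<open>The integer -n takes the place of \<open>w\<close>, with the trivial equation
    (-n)^2 = 0 * (-n) + n^2.\<close>
  have z_eq: "qf_eval r a z =
      qf_eval r a x + n\<^sup>2 * qf_eval r a y - n * polar_form r a x y"
    using qf_eval_quadratic_extension[of "-n" 0 "n\<^sup>2" r a x y]
    by (simp add: z_def mult.commute cong: qf_eval_cong)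
  \<comment> \<open>The functional applied to both coordinates: the right-hand side becomes (n + 1)
    - n * 1 = 1.\<close>
  have one: "qf_eval r a z + (m - (n\<^sup>2 + t * n)) * qf_eval r a y = 1"
  proof -
    have "qf_eval r a z + (m - (n\<^sup>2 + t * n)) * qf_eval r a y =
        (qf_eval r a x + m * qf_eval r a y) - n * (polar_form r a x y + t * qf_eval r a y)"
      unfolding z_eq by (simp add: algebra_simps)
    then show ?thesis
      unfolding c0 c1 by simp
  qed
  have y: "\<exists>i<r. y i \<noteq> 0"
  proof (rule ccontr)
    assume "\<not> ?thesis"
    then have "polar_form r a x y = 0" "qf_eval r a y = 0"
      unfolding polar_form_def qf_eval_def by simp_all
    with c1 show False by simp
  qed
  then have y_pos: "qf_eval r a y \<ge> 1"
    using Z_form_pos_int[OF Z] by fastforce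
  have z_nn: "qf_eval r a z \<ge> 0"
    by (rule Z_form_nonneg_int[OF Z])
  \<comment> \<open>Both factors are at least 1, so this summand alone exhausts the total 1.\<close>
  have "1 * 1 \<le> (m - (n\<^sup>2 + t * n)) * qf_eval r a y"
    using n y_pos by (intro mult_mono) auto
  with one z_nn have z0: "qf_eval r a z = 0" and p: "(m - (n\<^sup>2 + t * n)) * qf_eval r a y = 1"
    by linarith+
  from p have Qy: "qf_eval r a y = 1" and m: "m = n\<^sup>2 + t * n + 1"
    using n y_pos by (auto simp: zmult_eq_1_iff)
  \<comment> \<open>A zero of a definite form vanishes at all indices below
    \<open>r\<close>.\<close>
  have "x i = n * y i" if "i < r" for i
    using z0 that Z_form_pos_int[OF Z, of z] by (force simp: z_def)
  then have "polar_form r a x y = polar_form r a (\<lambda>i. n * y i) y"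
    by (intro polar_form_cong) auto
  also have "\<dots> = 2 * n"
    by (simp add: polar_form_scale_self Qy)
  finally have "2 * n + t = 1"
    using c1 Qy by simp
  with assms(2,3) have "n = 0" "t = 1"
    by presburger+
  with m show ?thesis by simp
qed

text \<open>\<open>n\<close> is the predecessor of the least natural number at which t X + X^2
  exceeds \<open>m\<close>; \<open>no_root\<close> makes the lower inequality strict.\<close>

lemma int_quadratic_bracket:
  fixes t m :: int
  assumes "t \<ge> 0" "m > 0" and no_root: "\<And>j. j\<^sup>2 + t * j \<noteq> m"
  obtains n where "n \<ge> 0" "n\<^sup>2 + t * n < m" "m < (n + 1)\<^sup>2 + t * (n + 1)"
proof -
  define P where "P k \<longleftrightarrow> m < (int k)\<^sup>2 + t * int k" for k
  \<comment> \<open>The witness m + 1 shows that such a number exists.\<close>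
  have "m < (m + 1)\<^sup>2 + t * (m + 1)"
    using assms(1,2) by (simp add: power2_eq_square algebra_simps add_pos_nonneg)
  then have "P (nat (m + 1))"
    using assms by (simp add: P_def)
  then have P: "P (LEAST k. P k)"
    by (rule LeastI)
  have "(LEAST k. P k) \<noteq> 0"
    using P assms by (intro notI) (simp add: P_def)
  then obtain k where k: "(LEAST k. P k) = Suc k"
    by (auto simp: gr0_conv_Suc)
  then have "\<not> P k"
    using not_less_Least[of k P] by simp
  then have "(int k)\<^sup>2 + t * int k < m"
    using no_root[of "int k"] by (simp add: P_def)
  moreover have "P (Suc k)"
    using P by (simp only: k)
  then have "m < (int k + 1)\<^sup>2 + t * (int k + 1)"
    by (simp add: P_def add.commute)
  ultimately show ?thesis
    using that[of "int k"] by simp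
qed

section \<open>Integrality of quadratic irrationalities\<close>

text \<open>
  The primitive integral multiple \<open>g\<close> of \<open>X\<^sup>2 - P X + N\<close> divides, by Gauss's lemma, any monic integral
  polynomial that vanishes at \<open>x\<close>; hence its leading coefficient is a unit.
\<close>

lemma algebraic_int_quadratic:
  fixes x P N :: "'a::field_char_0"
  assumes "algebraic_int x" "x \<notin> \<rat>" "P \<in> \<rat>" "N \<in> \<rat>" "x\<^sup>2 = P * x - N"
  shows "P \<in> \<int>" "N \<in> \<int>"
proof -
  obtain f :: "int poly" where f: "poly (map_poly of_int f) x = 0" "lead_coeff f = 1"
    using assms(1) by (auto simp: algebraic_int_altdef_ipoly)
  obtain e1 p1 where P: "e1 > 0" "P = of_int p1 / of_int e1"
    using assms(3) by (auto elim: Rats_cases')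
  obtain e2 n2 where N: "e2 > 0" "N = of_int n2 / of_int e2"
    using assms(4) by (auto elim: Rats_cases')
  \<comment> \<open>X^2 - P X + N multiplied by the denominators \<open>e1\<close> and
    \<open>e2\<close>.\<close>
  define g0 where "g0 = [:n2 * e1, - p1 * e2, e1 * e2:]"
  define g where "g = primitive_part g0"
  define c where "c = content g0"
  have "g0 \<noteq> 0" using P N by (simp add: g0_def)
  then have c0: "c \<noteq> 0" by (simp add: c_def)
  have g0: "g0 = smult c g"
    by (simp add: g_def c_def)
  have cg: "content g = 1"
    using \<open>g0 \<noteq> 0\<close> by (simp add: g_def)
  have deg: "degree g = 2"
  proof -
    have "degree g0 = 2" using P N by (simp add: g0_def)
    then show ?thesis using c0 by (simp add: g0)
  qed
  \<comment> \<open>Evaluating integral polynomials at \<open>x\<close> is a ring homomorphism, so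
    relations between them can be transported to \<open>x\<close>.\<close>
  have "map_poly of_int (p + q) = (map_poly of_int p + map_poly of_int q :: 'a poly)"
    and "map_poly of_int (smult k p) = (smult (of_int k) (map_poly of_int p) :: 'a poly)"
    for p q :: "int poly" and k
    by (rule poly_eqI, simp add: coeff_map_poly)+
  then have ip_add: "poly (map_poly of_int (p + q)) x =
      poly (map_poly of_int p) x + poly (map_poly of_int q) x"
    and ip_smult: "poly (map_poly of_int (smult k p)) x = of_int k * poly (map_poly of_int p) x"
    for p q :: "int poly" and k
    by simp_all
  have ip_mult: "poly (map_poly of_int (p * q)) x =
      poly (map_poly of_int p) x * poly (map_poly of_int q) x" for p q :: "int poly"
    by (induction p) (simp_all add: ip_add ip_smult map_poly_pCons algebra_simps)
  note ip = ip_add ip_smult ip_mult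
  have "poly (map_poly of_int g0) x = of_int (e1 * e2) * (x\<^sup>2 - P * x + N)"
    using P N by (simp add: g0_def map_poly_pCons power2_eq_square field_simps)
  also have "\<dots> = 0" using assms(5) by simp
  finally have gx: "poly (map_poly of_int g) x = 0"
    using c0 by (simp add: g0 ip)
  have "g \<noteq> 0" using deg by auto
  \<comment> \<open>\<open>g\<close> need not be monic, so division over the integers costs a
    nonzero factor \<open>k\<close>.\<close>
  then obtain k q where kq: "k \<noteq> 0" "smult k f = g * q + pseudo_mod f g"
    using pseudo_mod(1) by blast
  define r where "r = pseudo_mod f g"
  have "degree r \<le> 1"
    using pseudo_mod(2)[OF \<open>g \<noteq> 0\<close>, of f] deg by (auto simp: r_def)
  then obtain r0 r1 where r: "r = [:r0, r1:]"
    by (metis One_nat_def degree_pCons_eq_if degree_eq_zeroE le_zero_eq nat_le_linear not_less_eq_eq pCons_cases pCons_0_0)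
  have "poly (map_poly of_int r) x = 0"
    using arg_cong[OF kq(2), of "\<lambda>p. poly (map_poly of_int p) x"] f(1) gx
    by (simp add: ip r_def)
  then have rx: "of_int r0 + x * of_int r1 = 0"
    by (simp add: r map_poly_pCons)
  \<comment> \<open>A nonzero linear coefficient would make the root \<open>x\<close> of the
    remainder rational.\<close>
  have "r1 = 0"
  proof (rule ccontr)
    assume "r1 \<noteq> 0"
    with rx have "x = - of_int r0 / of_int r1"
      by (simp add: field_simps eq_neg_iff_add_eq_0)
    with assms(2) show False by simp
  qed
  with rx r have "r = 0" by simp
  then have kf: "smult k f = g * q"
    using kq by (simp add: r_def)
  \<comment> \<open>Contents are multiplicative, and those of \<open>f\<close> and \<open>g\<close>
    are 1; so \<open>q\<close> absorbs the whole factor \<open>k\<close>, which then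
    cancels.\<close>
  have "content f dvd 1"
    using content_dvd_coeff[of f "degree f"] f(2) by metis
  then have "content f = 1"
    by (simp only: is_unit_content_iff)
  then have "content q = normalize k"
    using arg_cong[OF kf, of content] cg by (simp add: content_mult)
  then have "[:k:] dvd q"
    by (simp add: const_poly_dvd_iff_dvd_content)
  then obtain q' where "q = smult k q'"
    by (auto elim!: dvdE)
  with kf kq(1) have "f = g * q'"
    by (metis mult_smult_right smult_cancel)
  then have "lead_coeff g dvd 1"
    using f(2) by (metis dvd_triv_left lead_coeff_mult)
  then have lg: "coeff g 2 = 1 \<or> coeff g 2 = -1"
    using deg by auto
  have co: "c * coeff g 0 = n2 * e1" "c * coeff g 1 = - p1 * e2" "c * coeff g 2 = e1 * e2"
    using g0 by (metis coeff_smult g0_def coeff_pCons_0 coeff_pCons_Suc One_nat_def numeral_2_eq_2)+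
  \<comment> \<open>The unit \<open>coeff g 2\<close> is its own inverse, which solves the third
    equation of \<open>co\<close> for \<open>c\<close>.\<close>
  have c_eq: "c = e1 * e2 * coeff g 2"
    using co(3) lg by auto
  have e: "e1 \<noteq> 0" "e2 \<noteq> 0" using P N by auto
  have "p1 * e2 = (- (coeff g 1 * coeff g 2) * e1) * e2"
    using co(2) c_eq by (simp add: algebra_simps)
  then have "p1 = - (coeff g 1 * coeff g 2) * e1"
    using e by (simp only: mult_cancel_right) simp
  then have "P = of_int (- (coeff g 1 * coeff g 2))"
    using e unfolding P(2) by (simp only: of_int_mult) simp
  then show "P \<in> \<int>" by simp
  have "n2 * e1 = (coeff g 0 * coeff g 2 * e2) * e1"
    using co(1) c_eq by (auto simp: mult_ac)
  then have "n2 = (coeff g 0 * coeff g 2) * e2"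
    using e by (simp only: mult_cancel_right) simp
  then have "N = of_int (coeff g 0 * coeff g 2)"
    using e unfolding N(2) by (simp only: of_int_mult) simp
  then show "N \<in> \<int>" by simp
qed

section \<open>Subfields, degree two, and real embeddings\<close>

lemma is_subfieldD:
  assumes "is_subfield K"
  shows "0 \<in> K" "1 \<in> K" "x \<in> K \<Longrightarrow> y \<in> K \<Longrightarrow> x + y \<in> K" "x \<in> K \<Longrightarrow> y \<in> K \<Longrightarrow> x * y \<in> K"
    "x \<in> K \<Longrightarrow> - x \<in> K" "x \<in> K \<Longrightarrow> inverse x \<in> K"
    "x \<in> K \<Longrightarrow> y \<in> K \<Longrightarrow> x - y \<in> K" "x \<in> K \<Longrightarrow> y \<in> K \<Longrightarrow> x / y \<in> K"
  using assms by (auto simp: is_subfield_def diff_conv_add_uminus divide_inverse simp del: add_uminus_conv_diff)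

lemma subfield_Rats:
  fixes K :: "'a::field_char_0 set"
  assumes "is_subfield K"
  shows "\<rat> \<subseteq> K"
proof
  fix x :: 'a assume "x \<in> \<rat>"
  then obtain a b where x: "x = of_int a / of_int b"
    by (auto elim: Rats_cases')
  have N: "of_nat n \<in> K" for n
    by (induction n) (auto intro: is_subfieldD[OF assms])
  have "of_int z \<in> K" for z
    by (cases z) (auto intro!: N is_subfieldD[OF assms] simp del: of_nat_Suc)
  then show "x \<in> K"
    unfolding x by (intro is_subfieldD[OF assms])
qed

text \<open>The rationals are the span of 1, of dimension at most 1, so some \<open>t\<close> in
  \<open>K\<close> is irrational. Then \<open>{t, 1}\<close> is independent and extends to a basis,
  which has no room for a third element.\<close>

lemma rat_degree_2_span:
  fixes K :: "'a::field_char_0 set"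
  assumes "is_subfield K" "rat_degree K = 2"
  obtains t where "t \<in> K" "t \<notin> \<rat>" "K = {a + b * t | a b. a \<in> \<rat> \<and> b \<in> \<rat>}"
proof -
  interpret V: vector_space "\<lambda>(q::rat) (x::'a). of_rat q * x"
    by (rule vector_space_rat)
  have span1: "V.span {1} = \<rat>"
    by (auto simp: V.span_singleton Rats_def)
  have dim: "V.dim K = 2"
    using assms(2) by (simp add: rat_degree_def)
  have "\<not> K \<subseteq> \<rat>"
    using V.dim_le_card[of K "{1}"] dim by (auto simp: span1)
  then obtain t where t: "t \<in> K" "t \<notin> \<rat>" by auto
  have ind: "V.independent {t, 1}"
    using t by (intro V.independent_insertI) (auto simp: span1 V.independent_empty)
  obtain B where B: "{t, 1} \<subseteq> B" "B \<subseteq> K" "V.independent B" "K \<subseteq> V.span B"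
    using V.maximal_independent_subset_extend[of "{t, 1}" K] ind t is_subfieldD[OF assms(1)] by auto
  have "card B = 2"
    using V.basis_card_eq_dim[OF B(2,4,3)] dim by simp
  moreover have "t \<noteq> 1" using t by auto
  then have "card {t, 1} = 2" by simp
  \<comment> \<open>\<open>card\<close> is 0 on infinite sets, so \<open>card B = 2\<close> also
    yields that \<open>B\<close> is finite.\<close>
  ultimately have "{t, 1} = B"
    using B(1) by (intro card_subset_eq) (auto intro: card_ge_0_finite)
  with B have "K \<subseteq> V.span {t, 1}" by simp
  also have "\<dots> \<subseteq> {a + b * t | a b. a \<in> \<rat> \<and> b \<in> \<rat>}"
  proof
    fix x assume "x \<in> V.span {t, 1}"
    then obtain k where "x - of_rat k * t \<in> \<rat>"
      by (auto simp: V.span_breakdown_eq[of _ t] span1)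
    then show "x \<in> {a + b * t | a b. a \<in> \<rat> \<and> b \<in> \<rat>}"
      by (intro CollectI exI[of _ "x - of_rat k * t"] exI[of _ "of_rat k"]) auto
  qed
  finally have "K \<subseteq> {a + b * t | a b. a \<in> \<rat> \<and> b \<in> \<rat>}" .
  moreover have "{a + b * t | a b. a \<in> \<rat> \<and> b \<in> \<rat>} \<subseteq> K"
    using t subfield_Rats[OF assms(1)] by (auto intro!: is_subfieldD[OF assms(1)])
  ultimately show ?thesis
    using that t by blast
qed

text \<open>Membership in \<open>K\<close> is carried along in the induction because an embedding is
  known to be additive only on \<open>K\<close>.\<close>

lemma real_embedding_of_nat:
  assumes "is_subfield K" "real_embedding K \<phi>"
  shows "of_nat n \<in> K \<and> \<phi> (of_nat n) = of_nat n"
proof (induction n)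
  case 0
  \<comment> \<open>That 0 goes to 0 is not part of \<open>real_embedding\<close>; it follows by
    cancellation.\<close>
  have "\<phi> (0 + 0) = \<phi> 0 + \<phi> 0"
    using assms is_subfieldD[OF assms(1)] unfolding real_embedding_def by blast
  then show ?case
    using is_subfieldD[OF assms(1)] by simp
next
  case (Suc n)
  then show ?case
    using assms(2) is_subfieldD[OF assms(1)] by (auto simp: real_embedding_def)
qed

lemma real_embedding_of_int:
  assumes "is_subfield K" "real_embedding K \<phi>"
  shows "\<phi> (of_int z) = of_int z"
proof (cases z)
  case (nonneg n)
  then show ?thesis using real_embedding_of_nat[OF assms] by simp
next
  case (neg n)
  have *: "of_nat (Suc n) \<in> K" "\<phi> (of_nat (Suc n)) = of_nat (Suc n)" "\<phi> 0 = 0"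
    using real_embedding_of_nat[OF assms, of "Suc n"] real_embedding_of_nat[OF assms, of 0] by auto
  then have "\<phi> (of_nat (Suc n) + - of_nat (Suc n)) = \<phi> (of_nat (Suc n)) + \<phi> (- of_nat (Suc n))"
    using assms is_subfieldD[OF assms(1)] unfolding real_embedding_def by blast
  with * have "\<phi> (- of_nat (Suc n)) = - of_nat (Suc n)"
    by (simp only: add.right_inverse)
  then show ?thesis by (simp add: neg)
qed

section \<open>Generator and ring of integers of a real quadratic field\<close>

text \<open>Completing the square in the equation of a generator \<open>t\<close> gives a rational
  square a / b. Rescaling by a rational number turns it into a squarefree integer, and a real
  embedding fixes the sign.\<close>

lemma real_quadratic_field_sqrt:
  fixes K :: "'a::field_char_0 set"
  assumes "real_quadratic_field K"
  obtains s d where "s \<in> K" "s \<notin> \<rat>" "s\<^sup>2 = of_int d" "d > 0" "squarefree d"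
    "K = {a + b * s | a b. a \<in> \<rat> \<and> b \<in> \<rat>}"
proof -
  obtain \<phi> where K: "is_subfield K" "rat_degree K = 2" and \<phi>: "real_embedding K \<phi>"
    using assms by (auto simp: real_quadratic_field_def)
  note sf = is_subfieldD[OF K(1)]
  obtain t where t: "t \<in> K" "t \<notin> \<rat>" and Kt: "K = {a + b * t | a b. a \<in> \<rat> \<and> b \<in> \<rat>}"
    using rat_degree_2_span[OF K] .
  have "t\<^sup>2 \<in> K" using t sf by (simp add: power2_eq_square)
  then obtain p q where pq: "t\<^sup>2 = p + q * t" "p \<in> \<rat>" "q \<in> \<rat>"
    unfolding Kt by blast
  have "p + (q / 2)\<^sup>2 \<in> \<rat>"
    using pq by (intro Rats_add Rats_power Rats_divide) auto
  then obtain a b where ab: "b > 0" "p + (q / 2)\<^sup>2 = of_int a / of_int b"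
    by (auto elim: Rats_cases')
  \<comment> \<open>a / b = a b / b^2, so a / b and a b differ by a rational square;
    \<open>e\<close> removes the square part of a b.\<close>
  define N where "N = a * b"
  define e where "e = square_part N"
  define d where "d = squarefree_part N"
  have N: "N = d * e\<^sup>2"
    unfolding d_def e_def by (rule squarefree_decompose)
  have tq: "(t - q / 2)\<^sup>2 = p + (q / 2)\<^sup>2"
  proof -
    have "(t - q / 2)\<^sup>2 = t\<^sup>2 - q * t + (q / 2)\<^sup>2"
      by (simp add: power2_diff)
    then show ?thesis
      by (simp add: pq(1))
  qed
  have e0: "e \<noteq> 0"
  proof
    assume "e = 0"
    then have "a = 0" using ab N by (auto simp: N_def)
    then have "t = q / 2" using tq ab by simp
    with t pq show False by simp
  qed
  define c :: 'a where "c = of_int b / of_int e"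
  define s where "s = (t - q / 2) * c"
  have c: "c \<in> \<rat>" "c \<noteq> 0" "b \<noteq> 0" using ab e0 by (auto simp: c_def)
  have "s\<^sup>2 = of_int a / of_int b * (of_int b / of_int e)\<^sup>2"
    by (simp only: s_def power_mult_distrib tq ab c_def)
  also have "\<dots> = of_int N / (of_int e)\<^sup>2"
    using c by (simp add: N_def power2_eq_square)
  also have "\<dots> = of_int d"
    using e0 by (simp add: N)
  finally have s2: "s\<^sup>2 = of_int d" .
  have ts: "t = s / c + q / 2" using c by (simp add: s_def)
  have sK: "s \<in> K"
    unfolding s_def using t c pq subfield_Rats[OF K(1)] sf(8)[of q 2]
    by (intro sf) auto
  have sQ: "s \<notin> \<rat>"
    using t(2) ts c pq(3) by (metis Rats_add Rats_divide Rats_number_of)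
  have Ks: "K = {a + b * s | a b. a \<in> \<rat> \<and> b \<in> \<rat>}" (is "_ = ?R")
  proof (intro subset_antisym subsetI)
    fix x assume "x \<in> K"
    then obtain a b where "x = a + b * t" "a \<in> \<rat>" "b \<in> \<rat>" unfolding Kt by blast
    then show "x \<in> ?R"
      using c pq unfolding ts
      by (intro CollectI exI[of _ "a + b * q / 2"] exI[of _ "b / c"]) (auto simp: algebra_simps)
  next
    fix x assume "x \<in> ?R"
    then show "x \<in> K" using sK subfield_Rats[OF K(1)] by (auto intro!: sf)
  qed
  \<comment> \<open>The embedding exhibits \<open>d\<close> as the square of a real number.\<close>
  have "\<phi> (s * s) = \<phi> s * \<phi> s"
    using \<phi> sK unfolding real_embedding_def by blast
  then have "real_of_int d = \<phi> s * \<phi> s"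
    using s2 real_embedding_of_int[OF K(1) \<phi>, of d] by (simp add: power2_eq_square)
  then have "real_of_int d \<ge> 0" by simp
  moreover have "d \<noteq> 0" by (simp add: d_def)
  ultimately have "d > 0" by simp
  moreover have "squarefree d"
    unfolding d_def by (rule squarefree_squarefree_part)
  ultimately show ?thesis
    using that[OF sK sQ s2 _ _ Ks] by simp
qed

text \<open>For q = a / b in lowest terms, b^2 divides d a^2, hence \<open>d\<close>; squarefreeness
  makes \<open>b\<close> a unit.\<close>

lemma squarefree_mult_square_Ints:
  fixes q :: "'a::field_char_0"
  assumes "squarefree (d::int)" "q \<in> \<rat>" "of_int d * q\<^sup>2 \<in> \<int>"
  shows "q \<in> \<int>"
proof -
  obtain a b where q: "b > 0" "coprime a b" "q = of_int a / of_int b"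
    using assms(2) by (auto elim: Rats_cases')
  obtain z where "of_int d * q\<^sup>2 = of_int z"
    using assms(3) by (auto elim: Ints_cases)
  then have "of_int (d * a\<^sup>2) = (of_int (z * b\<^sup>2) :: 'a)"
    using q by (simp add: field_simps)
  then have "d * a\<^sup>2 = z * b\<^sup>2"
    by (simp only: of_int_eq_iff)
  then have "b\<^sup>2 dvd d * a\<^sup>2" by simp
  then have "b\<^sup>2 dvd d"
    using q(2) by (simp add: coprime_dvd_mult_left_iff coprime_commute)
  then have "b dvd 1" using assms(1) by (rule squarefreeD[rotated])
  then show ?thesis using q by simp
qed

text \<open>The trace P = 2 a and the norm N = a^2 - d b^2 are integers. Then d (2 b)^2 = P^2 - 4 N
  is one too, so 2 b is an integer because \<open>d\<close> is squarefree.\<close>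

lemma integral_coordinates:
  fixes s :: "'a::field_char_0"
  assumes "s \<notin> \<rat>" "s\<^sup>2 = of_int d" "squarefree d" "a \<in> \<rat>" "b \<in> \<rat>"
    and "algebraic_int (a + b * s)"
  obtains P R where "2 * a = of_int P" "2 * b = of_int R" "4 dvd P\<^sup>2 - d * R\<^sup>2"
proof (cases "b = 0")
  \<comment> \<open>The element is rational here, so \<open>algebraic_int_quadratic\<close> does not
    apply.\<close>
  case True
  then have "a \<in> \<int>"
    using assms rational_algebraic_int_is_int by auto
  then obtain z where "a = of_int z" by (auto elim: Ints_cases)
  then show ?thesis
    using that[of "2 * z" 0] True by simp
next
  case False
  define x where "x = a + b * s"
  have "x \<notin> \<rat>"
  proof
    assume "x \<in> \<rat>"
    then have "(x - a) / b \<in> \<rat>" using assms by auto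
    with False assms(1) show False by (simp add: x_def)
  qed
  moreover have "x\<^sup>2 = (2 * a) * x - (a\<^sup>2 - of_int d * b\<^sup>2)"
    by (simp add: x_def power2_sum power_mult_distrib assms(2)) (simp add: power2_eq_square algebra_simps)
  ultimately have "2 * a \<in> \<int>" "a\<^sup>2 - of_int d * b\<^sup>2 \<in> \<int>"
    using algebraic_int_quadratic[of x "2 * a" "a\<^sup>2 - of_int d * b\<^sup>2"] assms
    by (auto simp: x_def)
  then obtain P N where P: "2 * a = of_int P" and N: "a\<^sup>2 - of_int d * b\<^sup>2 = of_int N"
    by (auto elim!: Ints_cases)
  have eq: "of_int d * (2 * b)\<^sup>2 = of_int (P\<^sup>2 - 4 * N)"
    unfolding of_int_diff of_int_mult of_int_power P [symmetric] N [symmetric]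
    by (simp add: power_mult_distrib algebra_simps)
  have "2 * b \<in> \<int>"
  proof (rule squarefree_mult_square_Ints[OF assms(3)])
    show "2 * b \<in> \<rat>"
      using assms(5) by simp
    show "of_int d * (2 * b)\<^sup>2 \<in> \<int>"
      unfolding eq by (rule Ints_of_int)
  qed
  then obtain R where R: "2 * b = of_int R" by (auto elim: Ints_cases)
  have "of_int (d * R\<^sup>2) = (of_int (P\<^sup>2 - 4 * N) :: 'a)"
    using eq unfolding R by simp
  then have "d * R\<^sup>2 = P\<^sup>2 - 4 * N" by (simp only: of_int_eq_iff)
  then show ?thesis using that[OF P R] by simp
qed

lemma square_mod_4: "(z::int)\<^sup>2 mod 4 = (if even z then 0 else 1)"
proof -
  have "z mod 4 = 0 \<or> z mod 4 = 1 \<or> z mod 4 = 2 \<or> z mod 4 = 3" by presburger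
  then have "(z mod 4)\<^sup>2 mod 4 = (if even (z mod 4) then 0 else 1)" by auto
  moreover have "even (z mod 4) = even z" by presburger
  ultimately show ?thesis by (simp add: power_mod)
qed

lemma algebraic_int_quadratic_combination:
  fixes w :: "'a::field_char_0"
  assumes "w\<^sup>2 = of_int t * w + of_int m"
  shows "algebraic_int (of_int x + of_int y * w)"
proof (rule algebraic_int.intros)
  \<comment> \<open>The roots are x + y w and its conjugate x + y (t - w); the coefficients are
    their product and their negated sum.\<close>
  let ?p = "[:of_int (x\<^sup>2 + t * x * y - m * y\<^sup>2), of_int (- 2 * x - t * y), 1:] :: 'a poly"
  show "lead_coeff ?p = 1" by simp
  show "\<forall>i. coeff ?p i \<in> \<int>"
    by (auto simp: coeff_pCons split: nat.splits)
  have "poly ?p (of_int x + of_int y * w) = (of_int y)\<^sup>2 * (w\<^sup>2 - of_int t * w - of_int m)"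
    by (simp add: power2_eq_square algebra_simps)
  then show "poly ?p (of_int x + of_int y * w) = 0"
    using assms by simp
qed

text \<open>For d = 1 mod 4 take w = (1 + s) / 2, t = 1, m = (d - 1) / 4; otherwise w = s, t = 0, m
  = d. The root \<open>s\<close> is kept to identify the field from \<open>t\<close> and
  \<open>m\<close>.\<close>

lemma ring_of_integers_real_quadratic:
  fixes K :: "'a::field_char_0 set"
  assumes "real_quadratic_field K"
  obtains s w :: 'a and t m :: int
  where "K = {a + b * s | a b. a \<in> \<rat> \<and> b \<in> \<rat>}" "s\<^sup>2 = of_int (if t = 1 then 4 * m + 1 else m)"
    "w\<^sup>2 = of_int t * w + of_int m" "w \<notin> \<rat>" "t = 0 \<or> t = 1" "m > 0"
    "ring_of_integers K = {of_int x + of_int y * w | x y. True}"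
proof -
  obtain s d where s: "s \<in> K" "s \<notin> \<rat>" "s\<^sup>2 = of_int d" "d > 0" "squarefree d"
    and K: "K = {a + b * s | a b. a \<in> \<rat> \<and> b \<in> \<rat>}"
    using real_quadratic_field_sqrt[OF assms] by blast
  have sf: "is_subfield K" using assms by (simp add: real_quadratic_field_def)
  \<comment> \<open>Common to both cases: it remains to rewrite the admissible half-integral
    coordinates in terms of \<open>w\<close>.\<close>
  have OK: "ring_of_integers K = {of_int x + of_int y * w | x y. True}"
    if w: "w \<in> K" "w\<^sup>2 = of_int t * w + of_int m"
      and *: "\<And>P R. 4 dvd P\<^sup>2 - d * R\<^sup>2 \<Longrightarrow>
        \<exists>x y. of_int P / 2 + of_int R / 2 * s = of_int x + of_int y * w"
    for w t m
  proof (intro subset_antisym subsetI)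
    fix z assume "z \<in> ring_of_integers K"
    then obtain a b where z: "z = a + b * s" "a \<in> \<rat>" "b \<in> \<rat>" "algebraic_int z"
      using K by (auto simp: ring_of_integers_def)
    then obtain P R where "2 * a = of_int P" "2 * b = of_int R" "4 dvd P\<^sup>2 - d * R\<^sup>2"
      using integral_coordinates[OF s(2,3,5)] by metis
    then have "a = of_int P / 2" "b = of_int R / 2"
      by (simp_all add: field_simps)
    then have "z = of_int P / 2 + of_int R / 2 * s"
      by (simp only: z(1))
    with *[OF \<open>4 dvd P\<^sup>2 - d * R\<^sup>2\<close>] show "z \<in> {of_int x + of_int y * w | x y. True}"
      by (simp only: mem_Collect_eq simp_thms)
  next
    fix z assume "z \<in> {of_int x + of_int y * w | x y. True}"
    then obtain x y where "z = of_int x + of_int y * w" by blast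
    then show "z \<in> ring_of_integers K"
      using algebraic_int_quadratic_combination[OF w(2)] w(1) subfield_Rats[OF sf]
      by (auto simp: ring_of_integers_def intro!: is_subfieldD[OF sf])
  qed
  have d4: "d mod 4 \<noteq> 0"
  proof
    assume "d mod 4 = 0"
    then have "2\<^sup>2 dvd d" by auto
    then have "2 dvd (1::int)" using s(5) by (rule squarefreeD[rotated])
    then show False by simp
  qed
  have mod4: "P\<^sup>2 mod 4 = d * R\<^sup>2 mod 4" if "4 dvd P\<^sup>2 - d * R\<^sup>2" for P R
    using that by (simp add: mod_eq_dvd_iff)
  show ?thesis
  proof (cases "d mod 4 = 1")
    case True
    define m where "m = d div 4"
    define w where "w = (1 + s) / 2"
    have d: "d = 4 * m + 1" using True unfolding m_def by presburger
    \<comment> \<open>For d = 1, \<open>m\<close> would be 0 and \<open>s\<close> rational.\<close>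
    have "d \<noteq> 1"
    proof
      assume "d = 1"
      then have "s = 1 \<or> s = -1" using s(3) by (simp add: power2_eq_1_iff)
      with s(2) show False by auto
    qed
    then have "m > 0" using d s(4) by linarith
    have sw: "s = 2 * w - 1" by (simp add: w_def field_simps)
    have w2: "w\<^sup>2 = of_int 1 * w + of_int m"
      using s(3) unfolding w_def d by (simp add: power2_eq_square field_simps)
    have wQ: "w \<notin> \<rat>" using s(2) unfolding sw by auto
    have wK: "w \<in> K" unfolding w_def using s(1) subfield_Rats[OF sf]
      by (intro is_subfieldD[OF sf]) auto
    have "\<exists>x y. of_int P / 2 + of_int R / 2 * s = of_int x + of_int y * w"
      if "4 dvd P\<^sup>2 - d * R\<^sup>2" for P R
    proof -
      \<comment> \<open>Modulo 4 this reads P^2 = R^2, so P and R have the same parity.\<close>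
      have "(P\<^sup>2) mod 4 = (d mod 4) * R\<^sup>2 mod 4"
        using mod4[OF that] by (simp add: mod_mult_left_eq)
      then have "even P \<longleftrightarrow> even R"
        using True by (simp add: square_mod_4 split: if_splits)
      then have "even (P - R)" by simp
      then obtain x where "P - R = 2 * x" by (rule evenE)
      then have "P = R + 2 * x" by simp
      then have "of_int P / 2 + of_int R / 2 * s = of_int x + of_int R * w"
        by (simp add: w_def field_simps)
      then show ?thesis by blast
    qed
    from OK[OF wK w2 this]
    show ?thesis using that[OF K _ w2 wQ _ \<open>m > 0\<close>] s(3) d by simp
  next
    case False
    have w2: "s\<^sup>2 = of_int 0 * s + of_int d" using s(3) by simp
    have "\<exists>x y. of_int P / 2 + of_int R / 2 * s = of_int x + of_int y * s"
      if "4 dvd P\<^sup>2 - d * R\<^sup>2" for P R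
    proof -
      have *: "(P\<^sup>2) mod 4 = d * (R\<^sup>2 mod 4) mod 4"
        using mod4[OF that] by (simp add: mod_mult_right_eq)
      \<comment> \<open>For odd R, \<open>d\<close> would be a square modulo 4, that is 0 or 1, and
        both are excluded.\<close>
      have "even R"
      proof (rule ccontr)
        assume "odd R"
        then have "P\<^sup>2 mod 4 = d mod 4" using * by (simp add: square_mod_4)
        with False d4 show False by (simp add: square_mod_4 split: if_splits)
      qed
      moreover from this have "even P"
        using * by (simp add: square_mod_4 split: if_splits)
      ultimately obtain x y where "P = 2 * x" "R = 2 * y" by (auto elim!: evenE)
      then have "of_int P / 2 + of_int R / 2 * s = of_int x + of_int y * s" by simp
      then show ?thesis by blast
    qed
    from OK[OF s(1) w2 this]
    show ?thesis using that[OF K _ w2 s(2) _ s(4)] s(3) by simp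
  qed
qed

section \<open>Total positivity of \<open>n + 1 + w\<close> and its representation\<close>

theorem theorem1:
  fixes K :: "'a::field_char_0 set"
  assumes "real_quadratic_field K"
    and "\<exists>r a. Z_form r a \<and> universal_over_integers K r a"
  shows "\<exists>s. s\<^sup>2 = 5 \<and> K = rat_adjoin s"
proof -
  obtain s w :: 'a and t m :: int where K: "K = {a + b * s | a b. a \<in> \<rat> \<and> b \<in> \<rat>}"
    and s: "s\<^sup>2 = of_int (if t = 1 then 4 * m + 1 else m)"
    and w: "w\<^sup>2 = of_int t * w + of_int m" "w \<notin> \<rat>" and t: "t = 0 \<or> t = 1" and "m > 0"
    and OK: "ring_of_integers K = {of_int x + of_int y * w | x y. True}"
    using ring_of_integers_real_quadratic[OF assms(1)] .
  obtain r a where Z: "Z_form r a" and U: "universal_over_integers K r a"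
    using assms(2) by blast
  have sf: "is_subfield K" using assms(1) by (simp add: real_quadratic_field_def)
  \<comment> \<open>Irrationality of \<open>w\<close> makes 1 and \<open>w\<close> independent, so
    coefficients may be compared.\<close>
  have coords: "x = x' \<and> y = y'"
    if "of_int x + of_int y * w = of_int x' + of_int y' * w" for x y x' y'
  proof -
    have *: "of_int (y - y') * w = of_int (x' - x)"
      using that by (simp add: algebra_simps)
    have "y = y'"
    proof (rule ccontr)
      assume "y \<noteq> y'"
      then have "w = of_int (x' - x) / of_int (y - y')"
        by (simp only: * [symmetric]) simp
      with w(2) show False by simp
    qed
    with * show ?thesis by simp
  qed
  \<comment> \<open>Otherwise X^2 - t X - m would split with integer roots -j and j + t, and
    \<open>w\<close> would be one of them.\<close>
  have no_root: "j\<^sup>2 + t * j \<noteq> m" for j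
  proof
    assume j: "j\<^sup>2 + t * j = m"
    have "(w - of_int (- j)) * (w - of_int (j + t)) = w\<^sup>2 - of_int t * w - of_int (j\<^sup>2 + t * j)"
      by (simp add: algebra_simps power2_eq_square)
    also have "\<dots> = 0"
      unfolding w(1) j by simp
    finally have "w = of_int (- j) \<or> w = of_int (j + t)"
      by (simp only: mult_eq_0_iff right_minus_eq)
    with w(2) show False by (metis Rats_of_int)
  qed
  have "t \<ge> 0"
    using t by auto
  then obtain n where n: "n \<ge> 0" "n\<^sup>2 + t * n < m" "m < (n + 1)\<^sup>2 + t * (n + 1)"
    using int_quadratic_bracket[of t m] \<open>m > 0\<close> no_root by blast
  define \<alpha> where "\<alpha> = of_int (n + 1) + of_int 1 * w"
  have \<alpha>: "\<alpha> \<in> ring_of_integers K" unfolding OK \<alpha>_def by blast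
  have "of_int 0 + of_int 1 * w \<in> ring_of_integers K"
    unfolding OK by blast
  then have wK: "w \<in> K"
    by (simp add: ring_of_integers_def)
  have "totally_positive K \<alpha>"
    unfolding totally_positive_def
  proof (intro allI impI)
    fix \<phi> assume \<phi>: "real_embedding K \<phi>"
    have iK: "of_int z \<in> K" for z using subfield_Rats[OF sf] by auto
    have "\<phi> (w * w) = \<phi> (of_int t * w) + \<phi> (of_int m)"
      using w(1) \<phi> wK iK is_subfieldD[OF sf] unfolding real_embedding_def power2_eq_square by metis
    then have u: "\<phi> w * \<phi> w = of_int t * \<phi> w + of_int m"
      using \<phi> wK iK real_embedding_of_int[OF sf \<phi>] by (simp add: real_embedding_def)
    \<comment> \<open>Only the equation u^2 = t u + m for u = \<phi> w enters, so all embeddings are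
      treated at once: u \<le> -(n + 1) would give m = u^2 - t u \<ge> (n + 1)^2 + t (n + 1),
      against the maximality of \<open>n\<close>.\<close>
    have "\<phi> w > - of_int (n + 1)"
    proof (rule ccontr)
      assume "\<not> ?thesis"
      then have le: "of_int (n + 1) \<le> - \<phi> w" by simp
      have "of_int (n + 1) * of_int (n + 1) + of_int t * of_int (n + 1) \<le>
          (- \<phi> w) * (- \<phi> w) + of_int t * (- \<phi> w)"
        using n(1) t by (intro add_mono mult_mono le mult_left_mono order.trans[OF _ le]) auto
      also have "\<dots> = of_int m" using u by simp
      finally have "real_of_int ((n + 1)\<^sup>2 + t * (n + 1)) \<le> of_int m"
        by (simp add: power2_eq_square)
      with n(3) show False by (simp only: of_int_le_iff)
    qed
    moreover have "\<phi> \<alpha> = of_int (n + 1) + \<phi> w"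
      using \<phi> wK iK[of "n + 1"] real_embedding_of_int[OF sf \<phi>, of "n + 1"]
      by (simp add: real_embedding_def \<alpha>_def del: of_int_add)
    ultimately show "\<phi> \<alpha> > 0" by simp
  qed
  with \<alpha> U obtain v where v: "\<And>i. i < r \<Longrightarrow> v i \<in> ring_of_integers K" "qf_eval r a v = \<alpha>"
    unfolding universal_over_integers_def by blast
  \<comment> \<open>With the bound on \<open>i\<close> inside the quantifiers, choice yields
    coordinate functions defined on all indices.\<close>
  from v(1) have "\<forall>i. \<exists>x y. i < r \<longrightarrow> v i = of_int x + of_int y * w"
    unfolding OK by blast
  then obtain x y where xy: "\<And>i. i < r \<Longrightarrow> v i = of_int (x i) + of_int (y i) * w"
    by metis
  have "\<alpha> = qf_eval r a (\<lambda>i. of_int (x i) + of_int (y i) * w)"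
    using v(2) xy by (metis (no_types, lifting) qf_eval_cong)
  also have "\<dots> = of_int (qf_eval r a x + m * qf_eval r a y) +
      of_int (polar_form r a x y + t * qf_eval r a y) * w"
    by (simp add: qf_eval_quadratic_extension[OF w(1)] of_int_qf_eval of_int_polar_form)
  finally have "qf_eval r a x + m * qf_eval r a y = n + 1"
    "polar_form r a x y + t * qf_eval r a y = 1"
    unfolding \<alpha>_def using coords by metis+
  then have "t = 1" "m = 1"
    using represented_imp_golden[OF Z n(1) _ n(2)] t by auto
  then have "s\<^sup>2 = 5" using s by simp
  moreover have "K = rat_adjoin s"
    unfolding rat_adjoin_def
  proof (rule hull_unique[symmetric])
    have "s = 0 + 1 * s" by simp
    then show "{s} \<subseteq> K" unfolding K using Rats_0 Rats_1 by blast
    fix L assume "{s} \<subseteq> L" "is_subfield L"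
    then show "K \<subseteq> L"
      unfolding K using subfield_Rats[of L] by (auto intro!: is_subfieldD(3,4)[of L])
  qed (rule sf)
  ultimately show ?thesis by blast
qed

end
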